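(* Let $D$ be a VFD and let $\Omega=\{\sqrt{xD}\mid x\in D\setminus\{0\},\ \sqrt{xD}\in{\rm Spec}(D)\}$. The following statements are equivalent. (1) $D$ is a UVFD. (2) Each two incomparable valuation elements of $D$ are coprime. (3) $D$ is a P$v$MD. (4) $D_P$ is a valuation domain for each $P\in\Omega$. (5) For all $A,B,C\in\Omega$ with $A\cup B\subseteq C$, $A$ and $B$ are comparable under inclusion.
   Context: Let $D$ be an integral domain with quotient field $K$. An overring of $D$ is a subring of $K$ containing $D$. A nonzero nonunit $a\in D$ is a valuation element of $D$ if there is a valuation domain $V$ that is an overring of $D$ with $aV\cap D=aD$. $D$ is a VFD (valuation factorization domain) if every nonzero nonunit of $D$ is a finite product of valuation elements. Two elements $x,y\in D$ are incomparable if the ideals $xD$ and $yD$ are incomparable under inclusion. A finite sequence (or product) of incomparable elements means that entries with distinct indices are pairwise incomparable. Two elements $a,b\in D$ are coprime if every $c\in D$ with $aD\cup bD\subseteq cD$ is a unit of $D$. $D$ is a UVFD (unique VFD) if (i) every nonzero nonunit of $D$ is a finite product of incomparable valuation elements of $D$, and (ii) whenever $n,m\in\mathbb{N}$ (positive integers) and $(a_i)_{i=1}^n$, $(b_j)_{j=1}^m$ are two sequences of incomparable valuation elements of $D$ with $\prod_{i=1}^n a_i=\prod_{j=1}^m b_j$, then $n=m$ and there is a permutation $\sigma$ of $\{1,\dots,n\}$ with $a_iD=b_{\sigma(i)}D$ for each $i$. For a nonzero fractional ideal $A$ let $A^{-1}=\{x\in K\mid xA\subseteq D\}$, $A_v=(A^{-1})^{-1}$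 and $A_t=\bigcup\{I_v\mid I\subseteq A,\ I$ a nonzero finitely generated fractional ideal$\}$. $A$ is $t$-invertible if $(AA^{-1})_t=D$. $D$ is a P$v$MD (Prüfer $v$-multiplication domain) if every nonzero finitely generated ideal of $D$ is $t$-invertible. *)

theory Defs
  imports "HOL-Computational_Algebra.Computational_Algebra"
begin

text \<open>
  The integral domain \<open>D\<close> is the type \<open>'a\<close> of class \<^class>\<open>idom\<close>, its quotient field \<open>K\<close> is the
  type \<open>'a fract\<close>, and \<open>D\<close> sits in \<open>K\<close> as \<open>range to_fract\<close>. Subsets of \<open>D\<close> have type \<open>'a set\<close>;
  overrings and fractional ideals have type \<open>'a fract set\<close>. Properties of \<open>D\<close> itself take a
  type argument \<open>TYPE('a)\<close>.
\<close>

section \<open>Ideals of the domain\<close>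

lemma module_ring: "module ((*) :: 'a::comm_ring_1 \<Rightarrow> 'a \<Rightarrow> 'a)"
  by unfold_locales (simp_all add: algebra_simps)

definition ring_ideal :: "'a::comm_ring_1 set \<Rightarrow> bool" where
  "ring_ideal I \<longleftrightarrow> module.subspace (*) I"

definition fg_ring_ideal :: "'a::comm_ring_1 set \<Rightarrow> bool" where
  "fg_ring_ideal I \<longleftrightarrow> (\<exists>S. finite S \<and> I = module.span (*) S)"

definition prime_ideal :: "'a::comm_ring_1 set \<Rightarrow> bool" where
  "prime_ideal P \<longleftrightarrow>
     ring_ideal P \<and> P \<noteq> UNIV \<and> (\<forall>a b. a * b \<in> P \<longrightarrow> a \<in> P \<or> b \<in> P)"

definition radical :: "'a::comm_ring_1 set \<Rightarrow> 'a set" where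
  "radical I = {x. \<exists>n\<ge>1. x ^ n \<in> I}"

definition principal :: "'a::comm_ring_1 \<Rightarrow> 'a set" where
  "principal x = range (\<lambda>d. x * d)"

definition incomparable :: "'a::comm_ring_1 \<Rightarrow> 'a \<Rightarrow> bool" where
  "incomparable x y \<longleftrightarrow>
     \<not> principal x \<subseteq> principal y \<and> \<not> principal y \<subseteq> principal x"

definition incomparable_seq :: "'a::comm_ring_1 list \<Rightarrow> bool" where
  "incomparable_seq xs \<longleftrightarrow>
     (\<forall>i<length xs. \<forall>j<length xs. i \<noteq> j \<longrightarrow> incomparable (xs ! i) (xs ! j))"

text \<open>The library's \<open>coprime\<close> needs a division operation, which a general \<^class>\<open>idom\<close> lacks.\<close>

definition coprime_elts :: "'a::comm_ring_1 \<Rightarrow> 'a \<Rightarrow> bool" where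
  "coprime_elts a b \<longleftrightarrow> (\<forall>c. principal a \<union> principal b \<subseteq> principal c \<longrightarrow> c dvd 1)"

definition Omega :: "'a::comm_ring_1 set set" where
  "Omega = {radical (principal x) | x. x \<noteq> 0 \<and> prime_ideal (radical (principal x))}"

section \<open>Overrings and valuation domains\<close>

definition is_subring :: "'k::field set \<Rightarrow> bool" where
  "is_subring R \<longleftrightarrow>
     0 \<in> R \<and> 1 \<in> R \<and> (\<forall>x\<in>R. \<forall>y\<in>R. x - y \<in> R \<and> x * y \<in> R)"

definition overring :: "'a::idom fract set \<Rightarrow> bool" where
  "overring R \<longleftrightarrow> is_subring R \<and> range to_fract \<subseteq> R"

text \<open>Subrings of a field are integral domains, so only total ordering by divisibility is added.\<close>

definition valuation_domain :: "'k::field set \<Rightarrow> bool" where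
  "valuation_domain V \<longleftrightarrow>
     is_subring V \<and> (\<forall>x\<in>V. \<forall>y\<in>V. (\<exists>z\<in>V. y = x * z) \<or> (\<exists>z\<in>V. x = y * z))"

definition localization :: "'a::idom set \<Rightarrow> 'a fract set" where
  "localization P = {to_fract a / to_fract s | a s. s \<notin> P}"

section \<open>Valuation elements, VFDs and UVFDs\<close>

definition valuation_element :: "'a::idom \<Rightarrow> bool" where
  "valuation_element a \<longleftrightarrow>
     a \<noteq> 0 \<and> \<not> a dvd 1 \<and>
     (\<exists>V. overring V \<and> valuation_domain V \<and>
          (\<lambda>v. to_fract a * v) ` V \<inter> range to_fract = to_fract ` principal a)"

definition VFD :: "'a::idom itself \<Rightarrow> bool" where
  "VFD _ \<longleftrightarrow>
     (\<forall>x::'a. x \<noteq> 0 \<and> \<not> x dvd 1 \<longrightarrow>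
        (\<exists>as. as \<noteq> [] \<and> (\<forall>a\<in>set as. valuation_element a) \<and> x = prod_list as))"

definition UVFD :: "'a::idom itself \<Rightarrow> bool" where
  "UVFD _ \<longleftrightarrow>
     (\<forall>x::'a. x \<noteq> 0 \<and> \<not> x dvd 1 \<longrightarrow>
        (\<exists>as. as \<noteq> [] \<and> (\<forall>a\<in>set as. valuation_element a) \<and> incomparable_seq as
              \<and> x = prod_list as)) \<and>
     (\<forall>(as::'a list) bs.
        as \<noteq> [] \<and> bs \<noteq> [] \<and>
        (\<forall>a\<in>set as. valuation_element a) \<and> (\<forall>b\<in>set bs. valuation_element b) \<and>
        incomparable_seq as \<and> incomparable_seq bs \<and> prod_list as = prod_list bs \<longrightarrow>
        length as = length bs \<and>
        (\<exists>\<sigma>. bij_betw \<sigma> {..<length as} {..<length as} \<and>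
             (\<forall>i<length as. principal (as ! i) = principal (bs ! \<sigma> i))))"

section \<open>Fractional ideals and PvMDs\<close>

definition frac_scale :: "'a::idom \<Rightarrow> 'a fract \<Rightarrow> 'a fract" where
  "frac_scale d x = to_fract d * x"

lemma module_frac_scale: "module (frac_scale :: 'a::idom \<Rightarrow> 'a fract \<Rightarrow> 'a fract)"
  by unfold_locales (simp_all add: frac_scale_def algebra_simps)

definition fractional_ideal :: "'a::idom fract set \<Rightarrow> bool" where
  "fractional_ideal A \<longleftrightarrow>
     module.subspace frac_scale A \<and> (\<exists>d. d \<noteq> 0 \<and> frac_scale d ` A \<subseteq> range to_fract)"

definition fg_fractional_ideal :: "'a::idom fract set \<Rightarrow> bool" where
  "fg_fractional_ideal A \<longleftrightarrow>
     fractional_ideal A \<and> (\<exists>S. finite S \<and> A = module.span frac_scale S)"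

definition frac_inverse :: "'a::idom fract set \<Rightarrow> 'a fract set" where
  "frac_inverse A = {x. (\<lambda>a. x * a) ` A \<subseteq> range to_fract}"

definition v_closure :: "'a::idom fract set \<Rightarrow> 'a fract set" where
  "v_closure A = frac_inverse (frac_inverse A)"

definition t_closure :: "'a::idom fract set \<Rightarrow> 'a fract set" where
  "t_closure A = \<Union> {v_closure I | I. I \<subseteq> A \<and> I \<noteq> {0} \<and> fg_fractional_ideal I}"

definition frac_mult :: "'a::idom fract set \<Rightarrow> 'a fract set \<Rightarrow> 'a fract set" where
  "frac_mult A B = module.span frac_scale {a * b | a b. a \<in> A \<and> b \<in> B}"

definition t_invertible :: "'a::idom fract set \<Rightarrow> bool" where
  "t_invertible A \<longleftrightarrow> t_closure (frac_mult A (frac_inverse A)) = range to_fract"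

definition PvMD :: "'a::idom itself \<Rightarrow> bool" where
  "PvMD _ \<longleftrightarrow>
     (\<forall>I::'a set. fg_ring_ideal I \<and> I \<noteq> {0} \<longrightarrow> t_invertible (to_fract ` I))"

end

theory Submission
  imports Defs
begin

text \<open>
  With the conditions numbered (1) UVFD, (2) coprimality of incomparable valuation elements,
  (3) PvMD, (4) valuation localizations, (5) tree order on \<open>Omega\<close>, the proof is the cycle
  (1) \<open>\<Longrightarrow>\<close> (2) \<open>\<Longrightarrow>\<close> (3) \<open>\<Longrightarrow>\<close> (4) \<open>\<Longrightarrow>\<close> (5) \<open>\<Longrightarrow>\<close> (2) \<open>\<Longrightarrow>\<close> (1).

  Everything rests on how rigid a valuation element \<open>a\<close> is. Since \<open>aV \<inter> D = aD\<close>, divisibility by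
  divisors of \<open>a\<close> can be tested in the valuation domain \<open>V\<close>. Hence nonunit divisors of \<open>a\<close> are
  again valuation elements, any two divisors of \<open>a\<close> are comparable
  (\<open>divisors_comparable\<close>), powers of \<open>a\<close> are valuation elements, and the radical of \<open>aD\<close> is prime.
  If \<open>a\<close> divides a power of a valuation element \<open>b\<close>, then \<open>a\<close> and \<open>b\<close> are both divisors of a
  valuation element, so they are comparable (\<open>comparable_if_dvd_power\<close>). Thus valuation elements
  with comparable radicals are comparable, which is (5) \<open>\<Longrightarrow>\<close> (2): a nonunit common divisor of \<open>a\<close>
  and \<open>b\<close> has a radical above those of \<open>a\<close> and \<open>b\<close>.

  The product of comparable valuation elements is a valuation element, so in a VFD factorizations
  into incomparable valuation elements always exist, by merging. In addition, valuation elements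
  of a VFD are primal (\<open>valuation_or_unit_primal\<close>), and so coprimality of \<open>x\<close> and \<open>y\<close> improves to
  the statement that \<open>w dvd u * x\<close> and \<open>w dvd u * y\<close> imply \<open>w dvd u\<close>
  (\<open>VFD_coprime_imp_v_gcd\<close>). Unlike coprimality, this condition passes to products. Under (2) it
  yields uniqueness of factorizations, that is (1), and, after cancelling comparable factors,
  greatest common divisors. If \<open>g\<close> is the greatest common divisor of generators of an ideal
  \<open>I\<close>, then \<open>I\<close> has inverse \<open>D/g\<close>, which makes it \<open>t\<close>-invertible and gives (3).

  For (1) \<open>\<Longrightarrow>\<close> (2), a nonunit common divisor \<open>c\<close> of \<open>a\<close> and \<open>b = c * b'\<close> would give the second
  factorization \<open>(c * a) * b'\<close> of \<open>a * b\<close>. For (3) \<open>\<Longrightarrow>\<close> (4), a finite set with inverse inside \<open>D\<close>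
  cannot lie in a prime that is the radical of a principal ideal, so a \<open>t\<close>-invertible ideal becomes
  principal at such a prime. Finally (4) \<open>\<Longrightarrow>\<close> (5) holds because the primes below \<open>C\<close> are primes
  of the localization at \<open>C\<close>, where they form a chain.
\<close>

section \<open>Divisibility\<close>

lemma principal_subset_iff: "principal x \<subseteq> principal y \<longleftrightarrow> y dvd x"
proof
  assume "principal x \<subseteq> principal y"
  moreover have "x \<in> principal x" by (auto simp: principal_def intro: range_eqI[of _ _ 1])
  ultimately show "y dvd x" by (auto simp: principal_def)
next
  assume "y dvd x"
  then obtain k where "x = y * k" ..
  then show "principal x \<subseteq> principal y" by (auto simp: principal_def mult.assoc)
qed

lemma incomparable_iff: "incomparable x y \<longleftrightarrow> \<not> x dvd y \<and> \<not> y dvd x"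
  by (auto simp: incomparable_def principal_subset_iff)

lemma incomparable_seq_iff: "incomparable_seq xs \<longleftrightarrow> sorted_wrt incomparable xs"
proof -
  have sym: "incomparable x y \<longleftrightarrow> incomparable y x" for x y :: 'a
    by (auto simp: incomparable_iff)
  have "incomparable (xs ! i) (xs ! j)"
    if "sorted_wrt incomparable xs" "i < length xs" "j < length xs" "i \<noteq> j" for i j
    using that sym by (cases i j rule: linorder_cases) (auto simp: sorted_wrt_iff_nth_less)
  then show ?thesis
    by (auto simp: incomparable_seq_def sorted_wrt_iff_nth_less)
qed

lemma coprime_elts_iff: "coprime_elts a b \<longleftrightarrow> (\<forall>c. c dvd a \<longrightarrow> c dvd b \<longrightarrow> c dvd 1)"
  by (auto simp: coprime_elts_def principal_subset_iff)

lemma radical_principal_iff: "x \<in> radical (principal a) \<longleftrightarrow> (\<exists>n\<ge>1. a dvd x ^ n)"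
  by (simp add: radical_def principal_def dvd_def image_iff)

lemma prod_list_split: "prod_list (us @ c # vs) = c * prod_list (us @ vs :: 'a::comm_monoid_mult list)"
  by (simp add: ac_simps)

lemma dvd_prod_list_member: "c \<in> set cs \<Longrightarrow> c dvd prod_list (cs :: 'a::comm_semiring_1 list)"
  by (induction cs) auto

section \<open>Valuation elements\<close>

text \<open>
Units are admitted so that the class is closed under divisors. The image equation that defines
valuation elements is replaced by its nontrivial inclusion, phrased as a divisibility test.
\<close>

definition valuation_or_unit :: "'a::idom \<Rightarrow> bool" where
  "valuation_or_unit a \<longleftrightarrow> a \<noteq> 0 \<and> (\<exists>V. overring V \<and> valuation_domain V \<and>
     (\<forall>x. to_fract x / to_fract a \<in> V \<longrightarrow> a dvd x))"

lemma valuation_element_iff: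
  "valuation_element a \<longleftrightarrow> valuation_or_unit a \<and> \<not> a dvd 1"
proof -
  have eq: "(\<lambda>v. to_fract a * v) ` V \<inter> range to_fract = to_fract ` principal a \<longleftrightarrow>
      (\<forall>x. to_fract x / to_fract a \<in> V \<longrightarrow> a dvd x)" (is "?L \<longleftrightarrow> ?R")
    if a: "a \<noteq> 0" and V: "overring V" for V
  proof
    assume L: ?L
    show ?R
    proof (intro allI impI)
      fix x assume x: "to_fract x / to_fract a \<in> V"
      have "to_fract x = to_fract a * (to_fract x / to_fract a)" using a by simp
      with x have "to_fract x \<in> (\<lambda>v. to_fract a * v) ` V" by blast
      with L have "to_fract x \<in> to_fract ` principal a" by blast
      then show "a dvd x" by (auto simp: principal_def simp del: to_fract_mult)
    qed
  next
    assume R: ?R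
    show ?L
    proof (intro equalityI subsetI)
      fix y assume "y \<in> (\<lambda>v. to_fract a * v) ` V \<inter> range to_fract"
      then obtain v x where vx: "v \<in> V" "to_fract x = to_fract a * v" "y = to_fract x" by auto
      have "to_fract x / to_fract a = v" using vx a by simp
      with R vx have "a dvd x" by simp
      then show "y \<in> to_fract ` principal a"
        using vx(3) by (auto simp: principal_def dvd_def simp del: to_fract_mult)
    next
      fix y assume "y \<in> to_fract ` principal a"
      then obtain d where "y = to_fract (a * d)"
        unfolding principal_def by blast
      moreover have "to_fract d \<in> V" using V by (auto simp: overring_def)
      ultimately show "y \<in> (\<lambda>v. to_fract a * v) ` V \<inter> range to_fract"
        by (metis IntI image_eqI rangeI to_fract_mult)
    qed
  qed
  have "(\<exists>V. overring V \<and> valuation_domain V \<and>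
          (\<lambda>v. to_fract a * v) ` V \<inter> range to_fract = to_fract ` principal a) \<longleftrightarrow>
        (\<exists>V. overring V \<and> valuation_domain V \<and> (\<forall>x. to_fract x / to_fract a \<in> V \<longrightarrow> a dvd x))"
    if "a \<noteq> 0"
    by (intro ex_cong1 conj_cong refl, rule eq[OF that])
  then show ?thesis unfolding valuation_element_def valuation_or_unit_def by argo
qed

text \<open>
The quotient field itself serves as the valuation overring.
\<close>

lemma unit_valuation_or_unit:
  assumes "a dvd 1" shows "valuation_or_unit (a::'a::idom)"
proof -
  have "overring (UNIV :: 'a fract set)" by (simp add: overring_def is_subring_def)
  moreover have "valuation_domain (UNIV :: 'a fract set)"
    unfolding valuation_domain_def is_subring_def
    by (auto, metis mult.commute nonzero_eq_divide_eq mult_zero_left)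
  moreover have "a \<noteq> 0" using assms by auto
  moreover have "a dvd x" for x using assms dvd_trans one_dvd by blast
  ultimately show ?thesis unfolding valuation_or_unit_def by blast
qed

lemma to_fract_in_overring: "overring V \<Longrightarrow> to_fract d \<in> V"
  by (auto simp: overring_def)

lemma overring_mult: "overring V \<Longrightarrow> x \<in> V \<Longrightarrow> y \<in> V \<Longrightarrow> x * y \<in> V"
  by (simp add: overring_def is_subring_def)

lemma overring_add:
  assumes "overring V" "x \<in> V" "y \<in> V" shows "x + y \<in> V"
proof -
  have "x - (0 - y) \<in> V" using assms unfolding overring_def is_subring_def by blast
  then show ?thesis by simp
qed

lemma overring_power: "overring V \<Longrightarrow> x \<in> V \<Longrightarrow> x ^ n \<in> V"
  by (induction n) (auto simp: overring_def is_subring_def)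

lemma valuation_overring_total:
  assumes "overring V" "valuation_domain V"
  obtains z where "z \<in> V" "to_fract y = to_fract x * z"
    | z where "z \<in> V" "to_fract x = to_fract y * z"
  using assms to_fract_in_overring unfolding valuation_domain_def by meson

text \<open>
The overring of \<open>a = d * e\<close> also works for \<open>d\<close>: multiplying by \<open>e\<close> turns a quotient with
denominator \<open>d\<close> into one with denominator \<open>a\<close>.
\<close>

lemma valuation_or_unit_dvd:
  assumes "valuation_or_unit a" "d dvd a"
  shows "valuation_or_unit d"
proof -
  obtain V where a: "a \<noteq> 0" and V: "overring V" "valuation_domain V"
    and contr: "\<And>x. to_fract x / to_fract a \<in> V \<Longrightarrow> a dvd x"
    using assms(1) unfolding valuation_or_unit_def by blast
  obtain e where e: "a = d * e" using assms(2) ..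
  have "d dvd x" if "to_fract x / to_fract d \<in> V" for x
  proof -
    have "to_fract (x * e) / to_fract a = to_fract x / to_fract d" using a e by simp
    with that contr have "a dvd x * e" by metis
    then show ?thesis using a e by simp
  qed
  moreover have "d \<noteq> 0" using a e by auto
  ultimately show ?thesis unfolding valuation_or_unit_def using V by blast
qed

text \<open>
In the valuation domain one of \<open>b\<close>, \<open>c\<close> divides the other, and the divisor \<open>b\<close> of \<open>a\<close> is itself
contracted from the overring, so that divisibility descends to the domain.
\<close>

lemma divisors_comparable:
  assumes "valuation_or_unit a" "b dvd a" "c dvd a"
  shows "b dvd c \<or> c dvd b"
proof -
  obtain V where a: "a \<noteq> 0" and V: "overring V" "valuation_domain V"
    and contr: "\<And>x. to_fract x / to_fract a \<in> V \<Longrightarrow> a dvd x"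
    using assms(1) unfolding valuation_or_unit_def by blast
  have key: "b dvd c" if "b dvd a" "z \<in> V" "to_fract c = to_fract b * z" for b c z
  proof -
    obtain e where e: "a = b * e" using \<open>b dvd a\<close> ..
    have "to_fract (c * e) / to_fract a = z" using a e that by simp
    with that contr have "a dvd c * e" by metis
    then show ?thesis using a e by simp
  qed
  show ?thesis using valuation_overring_total[OF V] key assms(2,3) by metis
qed

lemma valuation_or_unit_power:
  assumes "valuation_or_unit a"
  shows "valuation_or_unit (a ^ n)"
proof -
  obtain V where a: "a \<noteq> 0" and V: "overring V" "valuation_domain V"
    and contr: "\<And>x. to_fract x / to_fract a \<in> V \<Longrightarrow> a dvd x"
    using assms unfolding valuation_or_unit_def by blast
  have "a ^ n dvd x" if "to_fract x / to_fract (a ^ n) \<in> V" for x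
    using that
  proof (induction n arbitrary: x)
    case (Suc n)
    have "to_fract x / to_fract a = to_fract (a ^ n) * (to_fract x / to_fract (a ^ Suc n))"
      using a by simp
    also have "\<dots> \<in> V"
      by (rule overring_mult[OF V(1) to_fract_in_overring[OF V(1)] Suc.prems])
    finally have "a dvd x" by (rule contr)
    then obtain y where y: "x = a * y" ..
    have "to_fract y / to_fract (a ^ n) = to_fract x / to_fract (a ^ Suc n)"
      using a y by simp
    then have "a ^ n dvd y" using Suc by simp
    then show ?case using y by (simp add: mult_dvd_mono)
  qed simp
  then show ?thesis unfolding valuation_or_unit_def using a V(1,2) by auto
qed

text \<open>
If \<open>y = x * z\<close> in the valuation domain, then \<open>y\<^sup>2 = (x * y) * z\<close> is a multiple of \<open>a\<close> there, hence
also in the domain. This contains the primality of the radical of \<open>a\<close>.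
\<close>

lemma dvd_mult_imp_dvd_square:
  assumes "valuation_or_unit a" "a dvd x * y"
  shows "a dvd x ^ 2 \<or> a dvd y ^ 2"
proof -
  obtain V where a: "a \<noteq> 0" and V: "overring V" "valuation_domain V"
    and contr: "\<And>x. to_fract x / to_fract a \<in> V \<Longrightarrow> a dvd x"
    using assms(1) unfolding valuation_or_unit_def by blast
  have key: "a dvd y ^ 2" if "a dvd x * y" "z \<in> V" "to_fract y = to_fract x * z" for x y z
  proof -
    obtain e where e: "x * y = a * e" using \<open>a dvd x * y\<close> ..
    have "to_fract (y ^ 2) = to_fract (x * y) * z"
      by (simp add: power2_eq_square that(3))
    also have "\<dots> = to_fract a * (to_fract e * z)" unfolding e by simp
    finally have "to_fract (y ^ 2) / to_fract a = to_fract e * z" using a by simp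
    then show ?thesis
      using overring_mult[OF V(1) to_fract_in_overring[OF V(1)] that(2)] contr by simp
  qed
  show ?thesis using valuation_overring_total[OF V] key assms(2) by (metis mult.commute)
qed

lemma to_fract_power: "to_fract (x ^ n) = to_fract x ^ n"
  by (induction n) simp_all

text \<open>
For closure under addition, \<open>y = x * z\<close> in the valuation domain gives
\<open>(x + y) ^ n = x ^ n * (1 + z) ^ n\<close>.
\<close>

lemma prime_ideal_radical_valuation_element:
  assumes "valuation_element a"
  shows "prime_ideal (radical (principal a))"
proof -
  have vu: "valuation_or_unit a" and nonunit: "\<not> a dvd 1"
    using assms by (auto simp: valuation_element_iff)
  obtain V where a: "a \<noteq> 0" and V: "overring V" "valuation_domain V"
    and contr: "\<And>x. to_fract x / to_fract a \<in> V \<Longrightarrow> a dvd x"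
    using vu unfolding valuation_or_unit_def by blast
  have key: "a dvd (x + y) ^ n" if "a dvd x ^ n" "z \<in> V" "to_fract y = to_fract x * z" for x y z n
  proof -
    obtain e where e: "x ^ n = a * e" using \<open>a dvd x ^ n\<close> ..
    have "to_fract (x + y) = to_fract x * (1 + z)" using that by (simp add: algebra_simps)
    then have "to_fract ((x + y) ^ n) = to_fract (x ^ n) * (1 + z) ^ n"
      by (simp add: to_fract_power power_mult_distrib del: to_fract_add)
    also have "\<dots> = to_fract a * (to_fract e * (1 + z) ^ n)" unfolding e by simp
    finally have "to_fract ((x + y) ^ n) / to_fract a = to_fract e * (1 + z) ^ n" using a by simp
    moreover have "1 + z \<in> V"
      using overring_add[OF V(1) _ that(2)] to_fract_in_overring[OF V(1), of 1] by simp
    ultimately show ?thesis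
      using overring_mult[OF V(1) to_fract_in_overring[OF V(1)] overring_power[OF V(1)]] contr
      by simp
  qed
  have sum: "x + y \<in> radical (principal a)"
    if x: "x \<in> radical (principal a)" and y: "y \<in> radical (principal a)" for x y
  proof -
    obtain n m where nm: "n \<ge> 1" "m \<ge> 1" "a dvd x ^ n" "a dvd y ^ m"
      using x y by (auto simp: radical_principal_iff)
    show ?thesis
    proof (rule valuation_overring_total[OF V, of x y])
      fix z assume "z \<in> V" "to_fract x = to_fract y * z"
      with key[of y m z x] nm show ?thesis by (auto simp: radical_principal_iff add.commute)
    next
      fix z assume "z \<in> V" "to_fract y = to_fract x * z"
      with key[of x n z y] nm show ?thesis by (auto simp: radical_principal_iff)
    qed
  qed
  have "ring_ideal (radical (principal a))"
    unfolding ring_ideal_def module.subspace_def[OF module_ring]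
  proof (intro conjI ballI allI)
    show "0 \<in> radical (principal a)" by (auto simp: radical_principal_iff intro: exI[of _ 1])
  next
    fix c x assume "x \<in> radical (principal a)"
    then show "c * x \<in> radical (principal a)"
      by (auto simp: radical_principal_iff power_mult_distrib)
  qed (rule sum)
  moreover have "1 \<notin> radical (principal a)" using nonunit by (auto simp: radical_principal_iff)
  moreover have "x \<in> radical (principal a) \<or> y \<in> radical (principal a)"
    if xy: "x * y \<in> radical (principal a)" for x y
  proof -
    obtain n where n: "n \<ge> 1" "a dvd x ^ n * y ^ n"
      using xy by (auto simp: radical_principal_iff power_mult_distrib)
    from dvd_mult_imp_dvd_square[OF vu n(2)] have "a dvd x ^ (n * 2) \<or> a dvd y ^ (n * 2)"
      by (simp add: power_mult)
    moreover have "n * 2 \<ge> 1" using n by simp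
    ultimately show ?thesis unfolding radical_principal_iff by blast
  qed
  ultimately show ?thesis unfolding prime_ideal_def by blast
qed

text \<open>
Both \<open>a\<close> and \<open>b\<close> divide \<open>b ^ n\<close>, whose divisors form a chain. This lemma turns containment of
radicals into divisibility.
\<close>

lemma comparable_if_dvd_power:
  assumes "valuation_or_unit b" "a dvd b ^ n"
  shows "a dvd b \<or> b dvd a"
proof (cases n)
  case 0
  then show ?thesis using assms(2) by (metis dvd_trans one_dvd power_0)
next
  case (Suc m)
  then show ?thesis
    using divisors_comparable[OF valuation_or_unit_power[OF assms(1)] assms(2), of b] by simp
qed

text \<open>
If \<open>a\<close> divides \<open>b\<close>, then \<open>a * b\<close> is a divisor of \<open>b\<^sup>2\<close>.
\<close>

lemma valuation_or_unit_mult: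
  assumes "valuation_or_unit a" "valuation_or_unit b" "a dvd b \<or> b dvd a"
  shows "valuation_or_unit (a * b)"
proof -
  have "a * b dvd b ^ 2 \<or> a * b dvd a ^ 2" using assms(3) by (auto simp: power2_eq_square)
  then show ?thesis using assms valuation_or_unit_power valuation_or_unit_dvd by metis
qed

text \<open>
The radical of a nonunit \<open>a\<close> is prime, so it contains a factor \<open>c\<close> of the product. The exponent \<open>n\<close>
carries the induction, because each step through \<open>dvd_mult_imp_dvd_square\<close> doubles it.
\<close>

lemma dvd_prod_list_power_imp_comparable:
  assumes "valuation_or_unit a" "\<forall>c\<in>set cs. valuation_or_unit c" "a dvd prod_list cs ^ n"
  shows "a dvd 1 \<or> (\<exists>c\<in>set cs. a dvd c \<or> c dvd a)"
  using assms(2,3)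
proof (induction cs arbitrary: n)
  case (Cons c cs)
  have "a dvd c ^ n * prod_list cs ^ n" using Cons.prems by (simp add: power_mult_distrib)
  from dvd_mult_imp_dvd_square[OF assms(1) this]
  have "a dvd c ^ (n * 2) \<or> a dvd prod_list cs ^ (n * 2)" by (simp add: power_mult)
  then show ?case
    using comparable_if_dvd_power[of c a "n * 2"] Cons by auto
qed simp

section \<open>Primality of valuation elements\<close>

text \<open>
A nonunit \<open>a\<close> is comparable to some factor \<open>c\<close>. If \<open>a\<close> divides \<open>c\<close>, then \<open>a\<close> divides one of the
two products. Otherwise \<open>c\<close> is a divisor of \<open>a\<close>, and cancelling it leaves a shorter instance for
\<open>a / c\<close>.
\<close>

lemma valuation_or_unit_primal:
  assumes "valuation_or_unit a"
    and "\<forall>c\<in>set xs. valuation_or_unit c" and "\<forall>c\<in>set ys. valuation_or_unit c"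
    and "a dvd prod_list xs * prod_list ys"
  shows "\<exists>d e. a = d * e \<and> d dvd prod_list xs \<and> e dvd prod_list ys"
  using assms
proof (induction "length xs + length ys" arbitrary: a xs ys rule: less_induct)
  case less
  have "a dvd prod_list (xs @ ys) ^ 1" using less.prems by simp
  then have "a dvd 1 \<or> (\<exists>c\<in>set (xs @ ys). a dvd c \<or> c dvd a)"
    using dvd_prod_list_power_imp_comparable less.prems(1,2,3) by (metis Un_iff set_append)
  then
  consider "a dvd 1" | c where "c \<in> set xs \<union> set ys" "a dvd c"
    | c where "c \<in> set xs" "c dvd a" | c where "c \<in> set ys" "c dvd a"
    by (metis Un_iff set_append)
  then show ?case
  proof cases
    case 1
    then have "a = a * 1 \<and> a dvd prod_list xs \<and> 1 dvd prod_list ys"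
      using dvd_trans[OF _ one_dvd] by auto
    then show ?thesis by blast
  next
    case (2 c)
    then have "a dvd prod_list xs \<or> a dvd prod_list ys"
      by (metis Un_iff dvd_trans dvd_prod_list_member)
    then show ?thesis by (metis mult.right_neutral mult.left_neutral one_dvd)
  next
    case (3 c)
    obtain us vs where xs: "xs = us @ c # vs" using split_list[OF 3(1)] by blast
    obtain b where b: "a = c * b" using 3(2) ..
    have c0: "c \<noteq> 0" using less.prems(1) b by (auto simp: valuation_or_unit_def)
    have "c * b dvd c * (prod_list (us @ vs) * prod_list ys)"
      using less.prems(4) unfolding xs prod_list_split b by (simp only: mult.assoc)
    then have "b dvd prod_list (us @ vs) * prod_list ys" using c0 by simp
    moreover have "valuation_or_unit b" using valuation_or_unit_dvd[OF less.prems(1)] b by simp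
    ultimately obtain d e where "b = d * e" "d dvd prod_list (us @ vs)" "e dvd prod_list ys"
      using less.hyps[of "us @ vs" ys b] less.prems(2,3) xs by auto
    then have "a = (c * d) * e \<and> c * d dvd prod_list xs \<and> e dvd prod_list ys"
      unfolding xs prod_list_split b by (simp add: mult.assoc mult_dvd_mono)
    then show ?thesis by blast
  next
    case (4 c)
    obtain us vs where ys: "ys = us @ c # vs" using split_list[OF 4(1)] by blast
    obtain b where b: "a = c * b" using 4(2) ..
    have c0: "c \<noteq> 0" using less.prems(1) b by (auto simp: valuation_or_unit_def)
    have "c * b dvd c * (prod_list xs * prod_list (us @ vs))"
      using less.prems(4) unfolding ys prod_list_split b by (simp only: ac_simps)
    then have "b dvd prod_list xs * prod_list (us @ vs)" using c0 by simp
    moreover have "valuation_or_unit b" using valuation_or_unit_dvd[OF less.prems(1)] b by simp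
    ultimately obtain d e where "b = d * e" "d dvd prod_list xs" "e dvd prod_list (us @ vs)"
      using less.hyps[of xs "us @ vs" b] less.prems(2,3) ys by auto
    then have "a = d * (c * e) \<and> d dvd prod_list xs \<and> c * e dvd prod_list ys"
      unfolding ys prod_list_split b by (simp add: ac_simps mult_dvd_mono)
    then show ?thesis by blast
  qed
qed

lemma VFD_factorization:
  assumes "VFD TYPE('a::idom)" "x \<noteq> (0::'a)"
  shows "\<exists>as. (\<forall>a\<in>set as. valuation_or_unit a) \<and> x = prod_list as"
proof (cases "x dvd 1")
  case True
  then show ?thesis using unit_valuation_or_unit[of x] by (intro exI[of _ "[x]"]) simp
next
  case False
  then show ?thesis using assms unfolding VFD_def valuation_element_iff by blast
qed

lemma VFD_valuation_or_unit_primal: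
  assumes "VFD TYPE('a::idom)" "valuation_or_unit (a::'a)" "a dvd x * y"
  shows "\<exists>d e. a = d * e \<and> d dvd x \<and> e dvd y"
proof (cases "x = 0 \<or> y = 0")
  case True
  then show ?thesis by (metis dvd_0_right mult.left_neutral mult.right_neutral one_dvd)
next
  case False
  then obtain xs ys where "\<forall>c\<in>set xs. valuation_or_unit c" "x = prod_list xs"
    "\<forall>c\<in>set ys. valuation_or_unit c" "y = prod_list ys"
    using VFD_factorization[OF assms(1), of x] VFD_factorization[OF assms(1), of y] by auto
  then show ?thesis using valuation_or_unit_primal[OF assms(2), of xs ys] assms(3) by simp
qed

section \<open>Greatest common divisors that survive scaling\<close>

text \<open>
For \<open>g \<noteq> 0\<close> over a domain, this says that the fractional ideal generated by \<open>S\<close> has inverse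
\<open>D/g\<close>, equivalently that its \<open>v\<close>-closure is \<open>gD\<close>. The factor \<open>u\<close> makes the notion stable under
scaling, which plain greatest common divisors are not in general.
\<close>

definition v_gcd :: "'a::comm_ring_1 \<Rightarrow> 'a set \<Rightarrow> bool" where
  "v_gcd g S \<longleftrightarrow>
     (\<forall>s\<in>S. g dvd s) \<and> (\<forall>u w. (\<forall>s\<in>S. w dvd u * s) \<longrightarrow> w dvd u * g)"

lemma v_gcd_1_mult:
  assumes "v_gcd 1 {x, y}" "v_gcd 1 {x, z}"
  shows "v_gcd 1 {x, y * z}"
  unfolding v_gcd_def
proof (intro conjI allI impI)
  fix u w assume "\<forall>s\<in>{x, y * z}. w dvd u * s"
  then have *: "w dvd u * x" "w dvd (u * y) * z" by (auto simp: mult.assoc)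
  then have "w dvd (u * y) * x" by (metis dvd_mult2 mult.assoc mult.commute)
  with * assms(2) have "w dvd u * y" unfolding v_gcd_def by (metis empty_iff insert_iff mult.right_neutral)
  with * assms(1) show "w dvd u * 1" unfolding v_gcd_def by blast
qed simp

lemma v_gcd_1_prod_list:
  assumes "\<forall>y\<in>set ys. v_gcd 1 {x, y}"
  shows "v_gcd 1 {x, prod_list ys}"
  using assms
proof (induction ys)
  case Nil
  then show ?case by (simp add: v_gcd_def)
qed (simp add: v_gcd_1_mult)

lemma v_gcd_scale:
  assumes "v_gcd g {x, y}"
  shows "v_gcd (c * g) {c * x, c * y}"
  using assms unfolding v_gcd_def by (auto simp: mult_dvd_mono mult.assoc[symmetric])

lemma v_gcd_insert:
  assumes "v_gcd g S" "v_gcd h {x, g}"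
  shows "v_gcd h (insert x S)"
  using assms unfolding v_gcd_def by (auto intro: dvd_trans)

text \<open>
By induction on a factorization of \<open>w\<close> it suffices to treat one valuation element
\<open>a\<close>. Primality splits \<open>a = d * e = d' * e'\<close> with \<open>d\<close>, \<open>d'\<close> dividing \<open>u\<close>, \<open>e\<close> dividing \<open>x\<close> and
\<open>e'\<close> dividing \<open>y\<close>. As divisors of \<open>a\<close>, the elements \<open>e\<close> and \<open>e'\<close> are comparable, so the smaller one
is a common divisor of \<open>x\<close> and \<open>y\<close>, hence a unit, and \<open>a\<close> divides \<open>u\<close>.
\<close>

lemma VFD_coprime_imp_v_gcd:
  assumes VFD: "VFD TYPE('a::idom)" and cop: "coprime_elts (x::'a) y"
  shows "v_gcd 1 {x, y}"
  unfolding v_gcd_def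
proof (intro conjI allI impI)
  fix u w assume w: "\<forall>s\<in>{x, y}. w dvd u * s"
  show "w dvd u * 1"
  proof (cases "w = 0")
    case True
    have "x \<noteq> 0 \<or> y \<noteq> 0" using cop by (auto simp: coprime_elts_iff dest: spec[of _ 0])
    then show ?thesis using w True by auto
  next
    case False
    then obtain ws where ws: "\<forall>a\<in>set ws. valuation_or_unit a" "w = prod_list ws"
      using VFD_factorization[OF VFD] by metis
    have "prod_list ws dvd u" if "prod_list ws dvd u * x" "prod_list ws dvd u * y"
      using ws(1) that
    proof (induction ws arbitrary: u)
      case (Cons a ws)
      have a: "valuation_or_unit a" "a \<noteq> 0" using Cons.prems by (auto simp: valuation_or_unit_def)
      have "a dvd u * x" "a dvd u * y" using Cons.prems by (auto dest: dvd_mult_left)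
      then obtain d e d' e' where de: "a = d * e" "d dvd u" "e dvd x"
        and de': "a = d' * e'" "d' dvd u" "e' dvd y"
        using VFD_valuation_or_unit_primal[OF VFD a(1)] by metis
      have "e dvd e' \<or> e' dvd e"
        using divisors_comparable[OF a(1)] de(1) de'(1) by (metis dvd_triv_right)
      then have "e dvd 1 \<or> e' dvd 1"
        using cop de(3) de'(3) unfolding coprime_elts_iff by (metis dvd_trans)
      then have "a dvd u"
        using de de' by (metis mult.right_neutral mult_dvd_mono mult.commute dvd_refl dvd_trans)
      then obtain u' where u': "u = a * u'" ..
      have "prod_list ws dvd u' * x" "prod_list ws dvd u' * y"
        using Cons.prems a(2) by (auto simp: u' mult.assoc)
      then have "prod_list ws dvd u'" using Cons.IH Cons.prems(1) by (meson list.set_intros(2))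
      then show ?case by (simp add: u' mult_dvd_mono)
    qed simp
    then show ?thesis using w ws by simp
  qed
qed simp

section \<open>Consequences of coprimality of incomparable valuation elements\<close>

lemma v_gcd_1_if_incomparable:
  assumes VFD: "VFD TYPE('a::idom)"
    and cop: "\<forall>a b :: 'a. valuation_element a \<and> valuation_element b \<and> incomparable a b
            \<longrightarrow> coprime_elts a b"
    and "valuation_or_unit (a::'a)" "valuation_or_unit b" "\<not> a dvd b" "\<not> b dvd a"
  shows "v_gcd 1 {a, b}"
proof -
  have "valuation_element a" "valuation_element b"
    using assms(3-) dvd_trans one_dvd unfolding valuation_element_iff by blast+
  then show ?thesis
    using VFD_coprime_imp_v_gcd[OF VFD] cop assms(5,6) by (simp add: incomparable_iff)
qed

text \<open>
Comparable factors of the two products are cancelled until none is left. What remains are pairwise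
coprime factors, and then the products have the scaled greatest common divisor \<open>1\<close>. A comparable
pair \<open>a\<close>, \<open>b = a * d\<close> is replaced by \<open>d\<close> alone, which may be a unit.
\<close>

lemma v_gcd_exists_prod_list:
  assumes VFD: "VFD TYPE('a::idom)"
    and cop: "\<forall>a b :: 'a. valuation_element a \<and> valuation_element b \<and> incomparable a b
            \<longrightarrow> coprime_elts a b"
    and "\<forall>c\<in>set xs. valuation_or_unit (c::'a)" "\<forall>c\<in>set ys. valuation_or_unit c"
  shows "\<exists>g. v_gcd g {prod_list xs, prod_list ys}"
  using assms(3,4)
proof (induction "length xs + length ys" arbitrary: xs ys rule: less_induct)
  case less
  show ?case
  proof (cases "\<exists>a\<in>set xs. \<exists>b\<in>set ys. a dvd b \<or> b dvd a")
    case True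
    then obtain a b where ab: "a \<in> set xs" "b \<in> set ys" "a dvd b \<or> b dvd a" by blast
    obtain us us' where us: "xs = us @ a # us'" using split_list[OF ab(1)] by blast
    obtain vs vs' where vs: "ys = vs @ b # vs'" using split_list[OF ab(2)] by blast
    from ab(3) show ?thesis
    proof
      assume "a dvd b"
      then obtain d where d: "b = a * d" ..
      have "valuation_or_unit d"
        using valuation_or_unit_dvd[of b d] less.prems(2) ab(2) d by simp
      then obtain g where "v_gcd g {prod_list (us @ us'), prod_list (vs @ d # vs')}"
        using less.hyps[of "us @ us'" "vs @ d # vs'"] less.prems us vs by auto
      from v_gcd_scale[OF this, of a] have "v_gcd (a * g) {prod_list xs, prod_list ys}"
        unfolding us vs prod_list_split d by (simp only: mult.assoc)
      then show ?thesis ..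
    next
      assume "b dvd a"
      then obtain d where d: "a = b * d" ..
      have "valuation_or_unit d"
        using valuation_or_unit_dvd[of a d] less.prems(1) ab(1) d by simp
      then obtain g where "v_gcd g {prod_list (us @ d # us'), prod_list (vs @ vs')}"
        using less.hyps[of "us @ d # us'" "vs @ vs'"] less.prems us vs by auto
      from v_gcd_scale[OF this, of b] have "v_gcd (b * g) {prod_list xs, prod_list ys}"
        unfolding us vs prod_list_split d by (simp only: mult.assoc)
      then show ?thesis ..
    qed
  next
    case False
    have "v_gcd 1 {prod_list ys, x}" if "x \<in> set xs" for x
      using v_gcd_1_prod_list[of ys x] v_gcd_1_if_incomparable[OF VFD cop] less.prems False that
      by (metis insert_commute)
    then have "v_gcd 1 {prod_list ys, prod_list xs}" by (intro v_gcd_1_prod_list) blast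
    then show ?thesis by (metis insert_commute)
  qed
qed

lemma v_gcd_exists:
  assumes VFD: "VFD TYPE('a::idom)"
    and cop: "\<forall>a b :: 'a. valuation_element a \<and> valuation_element b \<and> incomparable a b
            \<longrightarrow> coprime_elts a b"
    and "finite (S :: 'a set)"
  shows "\<exists>g. v_gcd g S"
  using assms(3)
proof (induction S)
  case empty
  show ?case by (rule exI[of _ 0]) (simp add: v_gcd_def)
next
  case (insert x S)
  then obtain g where g: "v_gcd g S" by blast
  have "\<exists>h. v_gcd h {x, g}"
  proof (cases "x = 0 \<or> g = 0")
    case True
    then have "v_gcd g {x, g} \<or> v_gcd x {x, g}" by (auto simp: v_gcd_def)
    then show ?thesis by blast
  next
    case False
    then obtain xs gs where "\<forall>c\<in>set xs. valuation_or_unit c" "x = prod_list xs"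
      "\<forall>c\<in>set gs. valuation_or_unit c" "g = prod_list gs"
      using VFD_factorization[OF VFD, of x] VFD_factorization[OF VFD, of g] by auto
    then show ?thesis using v_gcd_exists_prod_list[OF VFD cop, of xs gs] by simp
  qed
  then show ?case using v_gcd_insert[OF g] by blast
qed

text \<open>
Some factor \<open>b\<close> is comparable to \<open>a\<close>. If \<open>b\<close> divides \<open>a\<close>, then every other factor is incomparable
to \<open>a\<close>, as otherwise it would be comparable to \<open>b\<close>. So \<open>a\<close> is coprime, even after scaling, to the
product of the other factors, and it divides \<open>b\<close>.
\<close>

lemma dvd_factor_if_dvd_incomparable_prod:
  assumes VFD: "VFD TYPE('a::idom)"
    and cop: "\<forall>a b :: 'a. valuation_element a \<and> valuation_element b \<and> incomparable a b
            \<longrightarrow> coprime_elts a b"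
    and a: "valuation_element (a::'a)" and bs: "\<forall>b\<in>set bs. valuation_element b"
    and inc: "sorted_wrt incomparable bs" and dvd: "a dvd prod_list bs"
  shows "\<exists>b\<in>set bs. a dvd b"
proof -
  have vu: "valuation_or_unit a" "\<forall>b\<in>set bs. valuation_or_unit b" "\<not> a dvd 1"
    using a bs by (auto simp: valuation_element_iff)
  obtain b where b: "b \<in> set bs" "a dvd b \<or> b dvd a"
    using dvd_prod_list_power_imp_comparable[of a bs 1] vu dvd by auto
  show ?thesis
  proof (cases "a dvd b")
    case True
    then show ?thesis using b(1) by blast
  next
    case False
    then have ba: "b dvd a" using b by blast
    obtain us vs where bs_eq: "bs = us @ b # vs" using split_list[OF b(1)] by blast
    have "v_gcd 1 {a, c}" if "c \<in> set (us @ vs)" for c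
    proof -
      have "incomparable b c \<or> incomparable c b"
        using inc that by (auto simp: bs_eq sorted_wrt_append)
      then have "\<not> b dvd c" "\<not> c dvd b" by (auto simp: incomparable_iff)
      then have "\<not> a dvd c" "\<not> c dvd a"
        using ba dvd_trans divisors_comparable[OF vu(1), of b c] by blast+
      moreover have "valuation_or_unit c" using vu(2) that bs_eq by simp
      ultimately show ?thesis using v_gcd_1_if_incomparable[OF VFD cop vu(1)] by blast
    qed
    then have "v_gcd 1 {a, prod_list (us @ vs)}" using v_gcd_1_prod_list[of "us @ vs" a] by blast
    moreover have "a dvd b * a" "a dvd b * prod_list (us @ vs)"
      using dvd unfolding bs_eq prod_list_split by simp_all
    ultimately have "a dvd b * 1" unfolding v_gcd_def by blast
    then show ?thesis using b(1) by auto
  qed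
qed

text \<open>
While \<open>a\<close> is comparable to an entry \<open>b\<close>, the valuation element \<open>a * b\<close> absorbs that entry.
\<close>

lemma merge_into_incomparable:
  assumes "valuation_element (a::'a::idom)" "\<forall>b\<in>set bs. valuation_element b"
    "sorted_wrt incomparable bs"
  shows "\<exists>cs. cs \<noteq> [] \<and> (\<forall>c\<in>set cs. valuation_element c) \<and> sorted_wrt incomparable cs
     \<and> a * prod_list bs = prod_list cs"
  using assms
proof (induction "length bs" arbitrary: a bs rule: less_induct)
  case less
  show ?case
  proof (cases "\<exists>b\<in>set bs. a dvd b \<or> b dvd a")
    case True
    then obtain b where b: "b \<in> set bs" "a dvd b \<or> b dvd a" by blast
    obtain us vs where bs: "bs = us @ b # vs" using split_list[OF b(1)] by blast
    have "valuation_or_unit (a * b)"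
      using b less.prems(1,2) valuation_or_unit_mult[of a b] by (simp add: valuation_element_iff)
    moreover have "\<not> a * b dvd 1"
      using less.prems(1) dvd_mult_left[of a b 1] by (auto simp: valuation_element_iff)
    ultimately have "valuation_element (a * b)" by (simp add: valuation_element_iff)
    moreover have "sorted_wrt incomparable (us @ vs)"
      using less.prems(3) by (auto simp: bs sorted_wrt_append)
    ultimately show ?thesis
      using less.hyps[of "us @ vs" "a * b"] less.prems(2)
      unfolding bs prod_list_split by (simp add: mult.assoc)
  next
    case False
    then have "sorted_wrt incomparable (a # bs)" using less.prems(3) by (simp add: incomparable_iff)
    then show ?thesis using less.prems(1,2) by (intro exI[of _ "a # bs"]) simp
  qed
qed

lemma incomparable_factorization:
  assumes "as \<noteq> []" "\<forall>a\<in>set as. valuation_element (a::'a::idom)"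
  shows "\<exists>cs. cs \<noteq> [] \<and> (\<forall>c\<in>set cs. valuation_element c) \<and> sorted_wrt incomparable cs
     \<and> prod_list as = prod_list cs"
  using assms
proof (induction as rule: list_nonempty_induct)
  case (single a)
  then show ?case by (intro exI[of _ "[a]"]) simp
next
  case (cons a as)
  then obtain bs where "\<forall>c\<in>set bs. valuation_element c" "sorted_wrt incomparable bs"
    "prod_list as = prod_list bs" by auto
  then show ?case using merge_into_incomparable[of a bs] cons.prems by simp
qed

text \<open>
For uniqueness, each factor on one side divides a factor on the other side, which divides a factor
on the first side. Incomparability makes this round trip the identity, so the two sides match up
to units.
\<close>

lemma UVFD_if_incomparable_coprime:
  assumes VFD: "VFD TYPE('a::idom)"
    and cop: "\<forall>a b :: 'a. valuation_element a \<and> valuation_element b \<and> incomparable a b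
            \<longrightarrow> coprime_elts a b"
  shows "UVFD TYPE('a)"
  unfolding UVFD_def
proof (intro conjI allI impI)
  fix x :: 'a assume "x \<noteq> 0 \<and> \<not> x dvd 1"
  then obtain as where as: "as \<noteq> []" "\<forall>a\<in>set as. valuation_element a" "x = prod_list as"
    using VFD unfolding VFD_def by blast
  show "\<exists>as. as \<noteq> [] \<and> (\<forall>a\<in>set as. valuation_element a) \<and> incomparable_seq as \<and> x = prod_list as"
    using incomparable_factorization[OF as(1,2)] as(3) by (simp add: incomparable_seq_iff)
next
  fix as bs :: "'a list"
  assume *: "as \<noteq> [] \<and> bs \<noteq> [] \<and>
        (\<forall>a\<in>set as. valuation_element a) \<and> (\<forall>b\<in>set bs. valuation_element b) \<and>
        incomparable_seq as \<and> incomparable_seq bs \<and> prod_list as = prod_list bs"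
  have dvd: "\<exists>j<length ys. xs ! i dvd ys ! j"
    if "\<forall>a\<in>set xs. valuation_element a" "\<forall>b\<in>set ys. valuation_element b"
      "incomparable_seq ys" "prod_list xs = prod_list ys" "i < length xs" for i and xs ys :: "'a list"
  proof -
    have "xs ! i dvd prod_list ys"
      using dvd_prod_list_member[of "xs ! i" xs] that by simp
    then show ?thesis
      using dvd_factor_if_dvd_incomparable_prod[OF VFD cop, of "xs ! i" ys] that nth_mem[of i xs]
      by (metis in_set_conv_nth incomparable_seq_iff)
  qed
  have unique: "i = j" if "incomparable_seq xs" "i < length xs" "j < length xs" "xs ! i dvd xs ! j"
    for i j and xs :: "'a list"
    using that unfolding incomparable_seq_def incomparable_iff by blast
  have match: "\<exists>j<length ys. xs ! i dvd ys ! j \<and> ys ! j dvd xs ! i"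
    if xs: "\<forall>a\<in>set xs. valuation_element a" "incomparable_seq xs"
      and ys: "\<forall>b\<in>set ys. valuation_element b" "incomparable_seq ys"
      and eq: "prod_list xs = prod_list ys" and i: "i < length xs"
    for i and xs ys :: "'a list"
  proof -
    obtain j where j: "j < length ys" "xs ! i dvd ys ! j"
      using dvd[OF xs(1) ys eq i] by blast
    obtain k where k: "k < length xs" "ys ! j dvd xs ! k"
      using dvd[OF ys(1) xs eq[symmetric] j(1)] by blast
    have "i = k" by (rule unique[OF xs(2) i k(1) dvd_trans[OF j(2) k(2)]])
    then show ?thesis using j k by blast
  qed
  have "\<forall>i. \<exists>j. i < length as \<longrightarrow> j < length bs \<and> as ! i dvd bs ! j \<and> bs ! j dvd as ! i"
    using match[of as bs] * by blast
  then obtain \<sigma> where \<sigma>: "\<sigma> i < length bs" "as ! i dvd bs ! \<sigma> i" "bs ! \<sigma> i dvd as ! i"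
    if "i < length as" for i
    unfolding choice_iff by blast
  have "bij_betw \<sigma> {..<length as} {..<length bs}"
    unfolding bij_betw_def
  proof (intro conjI equalityI subsetI)
    show "inj_on \<sigma> {..<length as}"
    proof (rule inj_onI)
      fix i k assume "i \<in> {..<length as}" "k \<in> {..<length as}" "\<sigma> i = \<sigma> k"
      then have ik: "i < length as" "k < length as" and dvds: "as ! i dvd bs ! \<sigma> i" "bs ! \<sigma> i dvd as ! k"
        using \<sigma>(2)[of i] \<sigma>(3)[of k] by simp_all
      show "i = k" using unique[OF _ ik dvd_trans[OF dvds]] * by blast
    qed
  next
    fix j assume j: "j \<in> {..<length bs}"
    have "j < length bs" using j by simp
    then obtain i where i: "i < length as" "bs ! j dvd as ! i"
      using match[of bs as j] * by metis
    have "j = \<sigma> i"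
      using unique[OF _ _ \<sigma>(1)[OF i(1)] dvd_trans[OF i(2) \<sigma>(2)[OF i(1)]]] j * by simp
    then show "j \<in> \<sigma> ` {..<length as}" using i(1) by blast
  qed (use \<sigma>(1) in auto)
  moreover from this have "length as = length bs" using bij_betw_same_card by force
  ultimately show "length as = length bs"
    and "\<exists>\<sigma>. bij_betw \<sigma> {..<length as} {..<length as} \<and>
             (\<forall>i<length as. principal (as ! i) = principal (bs ! \<sigma> i))"
    using \<sigma>(2,3) by (auto simp: set_eq_subset principal_subset_iff intro!: exI[of _ \<sigma>])
qed

section \<open>Unique factorization forces coprimality\<close>

lemma UVFD_unique:
  assumes "UVFD TYPE('a::idom)" "as \<noteq> []" "bs \<noteq> []"
    "\<forall>a\<in>set as. valuation_element (a::'a)" "\<forall>b\<in>set bs. valuation_element b"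
    "incomparable_seq as" "incomparable_seq bs" "prod_list as = prod_list bs"
  shows "\<exists>\<sigma>. bij_betw \<sigma> {..<length as} {..<length as} \<and>
             (\<forall>i<length as. principal (as ! i) = principal (bs ! \<sigma> i))"
  using assms(1)[unfolded UVFD_def, THEN conjunct2, THEN spec[of _ as], THEN spec[of _ bs]] assms(2-)
  by blast

text \<open>
Given a nonunit common divisor \<open>c\<close> and \<open>b = c * b'\<close>, the product \<open>a * b\<close> also equals
\<open>(c * a) * b'\<close>. These are again incomparable valuation elements, but \<open>c * a\<close> is associated
neither to \<open>a\<close> nor to \<open>b\<close>.
\<close>

lemma incomparable_coprime_if_UVFD:
  assumes UVFD: "UVFD TYPE('a::idom)"
    and a: "valuation_element (a::'a)" and b: "valuation_element b" and inc: "incomparable a b"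
  shows "coprime_elts a b"
  unfolding coprime_elts_iff
proof (intro allI impI, rule ccontr)
  fix c assume c: "c dvd a" "c dvd b" "\<not> c dvd 1"
  obtain b' where b': "b = c * b'" using c(2) ..
  have va: "valuation_or_unit a" and vb: "valuation_or_unit b"
    using a b by (auto simp: valuation_element_iff)
  have nab: "\<not> a dvd b" "\<not> b dvd a" using inc by (auto simp: incomparable_iff)
  have vc: "valuation_or_unit c" using valuation_or_unit_dvd[OF va c(1)] .
  have vb': "valuation_or_unit b'" using valuation_or_unit_dvd[OF vb] b' by simp
  have vca: "valuation_or_unit (c * a)" using valuation_or_unit_mult[OF vc va] c(1) by blast
  have "\<not> b' dvd 1"
  proof
    assume "b' dvd 1"
    then have "b dvd c * 1" unfolding b' by (rule mult_dvd_mono[OF dvd_refl])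
    also have "\<dots> dvd a" using c(1) by simp
    finally show False using nab(2) by contradiction
  qed
  have "\<not> c * a dvd 1" using c(3) dvd_mult_left[of c a 1] by blast
  have "\<not> c * a dvd b'" using nab(1) b' dvd_mult_right[of c a b'] dvd_mult[of a b' c] by blast
  have not_pow: "\<not> b dvd a ^ n" for n
    using comparable_if_dvd_power[OF va] nab by blast
  \<comment> \<open>Otherwise b would divide c * (c * a), hence a power of a, and would be comparable to a.\<close>
  have "\<not> b' dvd c * a"
  proof
    assume "b' dvd c * a"
    then have "b dvd c * (c * a)" unfolding b' by (rule mult_dvd_mono[OF dvd_refl])
    also have "\<dots> dvd a ^ 3"
      using c(1) by (simp add: power3_eq_cube mult_dvd_mono mult.assoc)
    finally show False using not_pow by blast
  qed
  have ve: "valuation_element (c * a)" "valuation_element b'"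
    using vca vb' \<open>\<not> c * a dvd 1\<close> \<open>\<not> b' dvd 1\<close> by (simp_all add: valuation_element_iff)
  have "incomparable_seq [c * a, b']" "incomparable_seq [a, b]"
    using \<open>\<not> c * a dvd b'\<close> \<open>\<not> b' dvd c * a\<close> inc
    by (simp_all add: incomparable_seq_iff incomparable_iff)
  moreover have "prod_list [c * a, b'] = prod_list [a, b]" unfolding b' by (simp add: ac_simps)
  ultimately obtain \<sigma> where \<sigma>: "bij_betw \<sigma> {..<length [c * a, b']} {..<length [c * a, b']}"
    "\<forall>i<length [c * a, b']. principal ([c * a, b'] ! i) = principal ([a, b] ! \<sigma> i)"
    using UVFD_unique[OF UVFD, of "[c * a, b']" "[a, b]"] ve a b by auto
  have "\<sigma> 0 \<in> {..<length [c * a, b']}" using bij_betwE[OF \<sigma>(1)] by simp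
  then have "\<sigma> 0 = 0 \<or> \<sigma> 0 = 1" by auto
  moreover have "principal (c * a) = principal ([a, b] ! \<sigma> 0)" using \<sigma>(2) by force
  ultimately have "principal (c * a) = principal a \<or> principal (c * a) = principal b"
    by (elim disjE) simp_all
  then have "c * a dvd a \<or> c * a dvd b" unfolding principal_subset_iff[symmetric] by blast
  moreover have "\<not> c * a dvd a"
  proof
    assume "c * a dvd a"
    moreover have "a \<noteq> 0" using va by (simp add: valuation_or_unit_def)
    ultimately show False using c(3) dvd_mult_cancel_right[of c a 1] by simp
  qed
  ultimately show False using nab(1) dvd_mult_right[of c a b] by blast
qed

section \<open>Fractional ideals\<close>

lemma fract_as_quotient:
  obtains u w where "x = to_fract u / to_fract w" "w \<noteq> 0"
  by (cases x rule: Fract_cases) (auto simp: Fract_conv_to_fract)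

lemma quotient_mult_integral_iff:
  assumes "w \<noteq> 0"
  shows "to_fract u / to_fract w * to_fract s \<in> range to_fract \<longleftrightarrow> w dvd u * s"
proof -
  have "to_fract u / to_fract w * to_fract s = to_fract k \<longleftrightarrow> u * s = w * k" for k
  proof -
    have "to_fract u / to_fract w * to_fract s = to_fract k \<longleftrightarrow> to_fract (u * s) = to_fract (w * k)"
      using assms by (simp add: field_simps)
    then show ?thesis by (simp only: to_fract_eq_iff)
  qed
  then show ?thesis by (auto simp: dvd_def image_iff)
qed

lemma subspace_range_to_fract: "module.subspace frac_scale (range to_fract)"
  unfolding module.subspace_def[OF module_frac_scale] frac_scale_def
  by (auto intro: range_eqI simp: to_fract_0[symmetric] to_fract_add[symmetric] to_fract_mult[symmetric]
      simp del: to_fract_0 to_fract_add to_fract_mult)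

lemma subspace_to_fract_image:
  assumes "ring_ideal I" shows "module.subspace frac_scale (to_fract ` I)"
proof -
  have I: "0 \<in> I" "\<And>x y. x \<in> I \<Longrightarrow> y \<in> I \<Longrightarrow> x + y \<in> I" "\<And>c x. x \<in> I \<Longrightarrow> c * x \<in> I"
    using assms unfolding ring_ideal_def module.subspace_def[OF module_ring] by blast+
  show ?thesis
    unfolding module.subspace_def[OF module_frac_scale] frac_scale_def
  proof (intro conjI ballI allI)
    show "0 \<in> to_fract ` I" using I(1) by (intro image_eqI[of _ _ 0]) simp_all
  next
    fix x y assume "x \<in> to_fract ` I" "y \<in> to_fract ` I"
    then obtain a b where "x = to_fract a" "y = to_fract b" "a \<in> I" "b \<in> I" by blast
    then show "x + y \<in> to_fract ` I" using I(2) by (intro image_eqI[of _ _ "a + b"]) simp_all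
  next
    fix c x assume "x \<in> to_fract ` I"
    then obtain a where "x = to_fract a" "a \<in> I" by blast
    then show "to_fract c * x \<in> to_fract ` I" using I(3) by (intro image_eqI[of _ _ "c * a"]) simp_all
  qed
qed

text \<open>
The means of passing from generators to the ideals that they span.
\<close>

lemma subspace_colon:
  assumes "module.subspace frac_scale N"
  shows "module.subspace frac_scale {z. y * z \<in> N}"
  using assms unfolding module.subspace_def[OF module_frac_scale] frac_scale_def
  by (simp add: distrib_left mult.left_commute[of y])

lemma frac_inverse_span: "frac_inverse (module.span frac_scale T) = frac_inverse T"
proof (intro equalityI subsetI)
  fix y assume "y \<in> frac_inverse (module.span frac_scale T)"
  then show "y \<in> frac_inverse T"
    using module.span_base[OF module_frac_scale] unfolding frac_inverse_def by blast
next
  fix y assume "y \<in> frac_inverse T"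
  then have "T \<subseteq> {z. y * z \<in> range to_fract}" by (auto simp: frac_inverse_def)
  then have "module.span frac_scale T \<subseteq> {z. y * z \<in> range to_fract}"
    by (rule module.span_minimal[OF module_frac_scale _ subspace_colon[OF subspace_range_to_fract]])
  then show "y \<in> frac_inverse (module.span frac_scale T)" by (auto simp: frac_inverse_def)
qed

lemma to_fract_span: "to_fract ` module.span (*) S = module.span frac_scale (to_fract ` S)"
proof -
  have "module_hom (*) frac_scale (to_fract :: 'a \<Rightarrow> 'a fract)"
    by (intro module_hom.intro module_ring module_frac_scale module_hom_axioms.intro)
      (simp_all add: frac_scale_def)
  from module_hom.span_image[OF this] show ?thesis by simp
qed

lemma frac_mult_inverse_integral: "frac_mult A (frac_inverse A) \<subseteq> range to_fract"
  unfolding frac_mult_def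
  by (rule module.span_minimal[OF module_frac_scale _ subspace_range_to_fract])
    (auto simp: frac_inverse_def mult.commute)

text \<open>
With \<open>x = u / w\<close>, membership in either side is a divisibility of multiples of \<open>u\<close> by \<open>w\<close>.
\<close>

lemma frac_inverse_v_gcd:
  assumes "v_gcd g S"
  shows "x \<in> frac_inverse (to_fract ` S) \<longleftrightarrow> x * to_fract g \<in> range to_fract"
proof -
  obtain u w where x: "x = to_fract u / to_fract w" "w \<noteq> 0" by (rule fract_as_quotient)
  have "x \<in> frac_inverse (to_fract ` S) \<longleftrightarrow> (\<forall>s\<in>S. w dvd u * s)"
    unfolding frac_inverse_def x(1) quotient_mult_integral_iff[OF x(2), symmetric] by blast
  also have "\<dots> \<longleftrightarrow> w dvd u * g"
    using assms unfolding v_gcd_def by (meson dvd_refl dvd_trans mult_dvd_mono)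
  finally show ?thesis by (simp only: x(1) quotient_mult_integral_iff[OF x(2)])
qed

text \<open>
The ideal spanned by \<open>T\<close> already has \<open>v\<close>-closure containing the whole domain, and no integral ideal
has a \<open>v\<close>-closure exceeding it.
\<close>

lemma t_closure_eq_D:
  assumes A: "(A :: 'a::idom fract set) \<subseteq> range to_fract" and T: "finite T" "module.span frac_scale T \<subseteq> A" "\<not> T \<subseteq> {0}"
    and inv: "frac_inverse T \<subseteq> range to_fract"
  shows "t_closure A = range to_fract"
proof (intro equalityI subsetI)
  fix x assume "x \<in> t_closure A"
  then obtain I where I: "x \<in> v_closure I" "I \<subseteq> A" by (auto simp: t_closure_def)
  have "1 \<in> frac_inverse I" using I(2) A by (auto simp: frac_inverse_def)
  then have "x * 1 \<in> range to_fract"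
    using I(1) unfolding v_closure_def frac_inverse_def by blast
  then show "x \<in> range to_fract" by simp
next
  fix x :: "'a fract" assume x: "x \<in> range to_fract"
  let ?I = "module.span frac_scale T"
  have "frac_scale 1 ` ?I \<subseteq> range to_fract" using A T(2) by (auto simp: frac_scale_def)
  then have "fg_fractional_ideal ?I"
    unfolding fg_fractional_ideal_def fractional_ideal_def
    using T(1) module.subspace_span[OF module_frac_scale] one_neq_zero by blast
  moreover have "?I \<noteq> {0}" using T(3) module.span_superset[OF module_frac_scale, of T] by blast
  moreover have "x * z \<in> range to_fract" if "z \<in> frac_inverse T" for z
  proof -
    obtain d k where "x = to_fract d" "z = to_fract k" using x inv \<open>z \<in> frac_inverse T\<close> by blast
    then have "x * z = to_fract (d * k)" by simp
    then show ?thesis by (rule range_eqI)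
  qed
  then have "x \<in> v_closure ?I"
    unfolding v_closure_def frac_inverse_span frac_inverse_def[of "frac_inverse T"] by blast
  ultimately show "x \<in> t_closure A" using T(2) unfolding t_closure_def by blast
qed

text \<open>
Conversely, \<open>1\<close> lies in the \<open>v\<close>-closure of a finitely generated part of \<open>A\<close>, and this forces the
inverse of that part into the domain.
\<close>

lemma finite_subset_if_t_closure_eq_D:
  assumes "t_closure A = range to_fract"
  obtains T where "finite T" "T \<subseteq> A" "frac_inverse T \<subseteq> range to_fract"
proof -
  have "1 \<in> t_closure A" unfolding assms by (metis rangeI to_fract_1)
  then obtain I where I: "1 \<in> v_closure I" "I \<subseteq> A" "fg_fractional_ideal I"
    by (auto simp: t_closure_def)
  obtain T where T: "finite T" "I = module.span frac_scale T"
    using I(3) by (auto simp: fg_fractional_ideal_def)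
  have "frac_inverse T \<subseteq> range to_fract"
    using I(1) unfolding T(2) v_closure_def frac_inverse_span by (auto simp: frac_inverse_def)
  moreover have "T \<subseteq> A" using I(2) T(2) module.span_superset[OF module_frac_scale, of T] by blast
  ultimately show ?thesis using that T(1) by blast
qed

section \<open>Prufer v-multiplication domains\<close>

text \<open>
If \<open>g\<close> is the scaled greatest common divisor of generators \<open>S\<close> of \<open>I\<close>, then \<open>1/g\<close> lies in the
inverse of \<open>I\<close>, so \<open>I\<close> times its inverse contains the elements \<open>s / g\<close>. An element \<open>z\<close> in the inverse
of all \<open>s / g\<close> has \<open>z / g\<close> in the inverse of \<open>I\<close>, hence is integral.
\<close>

lemma PvMD_if_v_gcd:
  assumes gcd: "\<And>S :: 'a::idom set. finite S \<Longrightarrow> \<exists>g. v_gcd g S"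
  shows "PvMD TYPE('a)"
  unfolding PvMD_def
proof (intro allI impI, elim conjE)
  fix I :: "'a set" assume "fg_ring_ideal I" and I0: "I \<noteq> {0}"
  then obtain S where S: "finite S" "I = module.span (*) S" by (auto simp: fg_ring_ideal_def)
  have "\<not> S \<subseteq> {0}"
  proof
    assume "S \<subseteq> {0}"
    then have "module.span (*) S = {0}"
      using module.span_minimal[OF module_ring] module.subspace_single_0[OF module_ring]
        module.span_zero[OF module_ring] by blast
    then show False using I0 S(2) by simp
  qed
  then obtain s where s: "s \<in> S" "s \<noteq> 0" by blast
  obtain g where g: "v_gcd g S" using gcd[OF S(1)] by blast
  have g0: "g \<noteq> 0" using g s unfolding v_gcd_def by auto
  let ?A = "to_fract ` I" and ?T = "(\<lambda>s. to_fract s / to_fract g) ` S"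
  have A: "?A = module.span frac_scale (to_fract ` S)" unfolding S(2) by (rule to_fract_span)
  have inv: "x \<in> frac_inverse ?A \<longleftrightarrow> x * to_fract g \<in> range to_fract" for x
    unfolding A frac_inverse_span by (rule frac_inverse_v_gcd[OF g])
  have "1 / to_fract g \<in> frac_inverse ?A"
    unfolding inv using g0 by (simp, metis rangeI to_fract_1)
  moreover have "to_fract ` S \<subseteq> ?A" unfolding A by (rule module.span_superset[OF module_frac_scale])
  ultimately have "to_fract s * (1 / to_fract g) \<in> {a * b |a b. a \<in> ?A \<and> b \<in> frac_inverse ?A}"
    if "s \<in> S" for s
    using that by blast
  then have "?T \<subseteq> {a * b |a b. a \<in> ?A \<and> b \<in> frac_inverse ?A}" by auto
  then have "module.span frac_scale ?T \<subseteq> frac_mult ?A (frac_inverse ?A)"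
    unfolding frac_mult_def by (rule module.span_mono[OF module_frac_scale])
  moreover have "frac_inverse ?T \<subseteq> range to_fract"
  proof
    fix z assume "z \<in> frac_inverse ?T"
    then have "z * (to_fract s / to_fract g) \<in> range to_fract" if "s \<in> S" for s
      using that unfolding frac_inverse_def by blast
    then have "z / to_fract g \<in> frac_inverse (to_fract ` S)" by (auto simp: frac_inverse_def)
    then have "z / to_fract g \<in> frac_inverse ?A" unfolding A frac_inverse_span .
    then show "z \<in> range to_fract" using inv g0 by simp
  qed
  moreover have "\<not> ?T \<subseteq> {0}" using s g0 by auto
  ultimately show "t_invertible ?A"
    unfolding t_invertible_def
    using t_closure_eq_D[OF frac_mult_inverse_integral] S(1) by blast
qed

text \<open>
If \<open>x\<close> may be cancelled against \<open>S\<close>, then it may be cancelled against any family of powers of the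
elements of \<open>S\<close>: lowering one exponent at a time moves a factor \<open>s\<close> into \<open>u\<close>. This replaces the
fact that a proper ideal \<open>xD\<close> that equals its own \<open>v\<close>-closure contains no power of a finitely
generated ideal whose inverse is \<open>D\<close>.
\<close>

lemma dvd_one_if_dvd_powers:
  assumes fin: "finite S" and canc: "\<And>u. (\<forall>s\<in>S. x dvd u * s) \<Longrightarrow> x dvd u"
    and "\<forall>s\<in>S. x dvd s ^ n s"
  shows "x dvd (1::'a::comm_ring_1)"
proof -
  have "x dvd u" if "\<forall>s\<in>S. x dvd u * s ^ n s" for u
    using that
  proof (induction "sum n S" arbitrary: n u rule: less_induct)
    case less
    show ?case
    proof (cases "\<exists>s\<in>S. n s = 0")
      case True
      then show ?thesis using less.prems by force
    next
      case False
      have "x dvd u * s" if s: "s \<in> S" for s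
      proof (rule less.hyps)
        have "n s > 0" using False s by auto
        then show "sum (n(s := n s - 1)) S < sum n S"
          using fin s by (intro sum_strict_mono_ex1) auto
        show "\<forall>t\<in>S. x dvd u * s * t ^ (n(s := n s - 1)) t"
        proof
          fix t assume t: "t \<in> S"
          have "x dvd u * t ^ n t" using less.prems t by blast
          moreover have "u * s * t ^ (n(s := n s - 1)) t = u * t ^ n t" if "t = s"
            using that \<open>n s > 0\<close> by (simp add: mult.assoc power_Suc[symmetric] del: power_Suc)
          moreover have "u * s * t ^ (n(s := n s - 1)) t = u * t ^ n t * s" if "t \<noteq> s"
            using that by (simp add: mult.assoc mult.commute[of s])
          ultimately show "x dvd u * s * t ^ (n(s := n s - 1)) t"
            by (metis dvd_mult2)
        qed
      qed
      then show ?thesis using canc by blast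
    qed
  qed
  from this[of 1] assms(3) show ?thesis by simp
qed

text \<open>
Let \<open>I\<close> be generated by \<open>a\<close> and \<open>b\<close>. By \<open>t\<close>-invertibility, \<open>I\<close> times its inverse contains a finite
set \<open>T\<close> whose inverse is integral. If \<open>T\<close> were inside \<open>P\<close>, powers of its elements would be divisible
by \<open>x\<close>, and \<open>x\<close> would be a unit. So for some \<open>y\<close> in the inverse of \<open>I\<close> one of \<open>s = a * y\<close>,
\<open>t = b * y\<close> is an element of the domain outside \<open>P\<close>, and \<open>a * t = b * s\<close>.
\<close>

lemma PvMD_imp_comparable_outside:
  assumes PvMD: "PvMD TYPE('a::idom)" and x: "x \<noteq> (0::'a)" and P: "P = radical (principal x)"
    and prime: "prime_ideal P" and ab: "a \<noteq> 0 \<or> b \<noteq> 0"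
  shows "\<exists>s t. s \<notin> P \<and> (a * s = b * t \<or> b * s = a * t)"
proof -
  let ?G = "to_fract ` {a, b}" and ?A = "to_fract ` module.span (*) {a, b}"
  have A: "?A = module.span frac_scale ?G" by (rule to_fract_span)
  have ideal: "ring_ideal P" using prime by (simp add: prime_ideal_def)
  note P_sub = subspace_to_fract_image[OF ideal]
  have "{a, b} \<subseteq> module.span (*) {a, b}" by (rule module.span_superset[OF module_ring])
  then have "module.span (*) {a, b} \<noteq> {0}" using ab by auto
  then have "t_invertible ?A"
    using PvMD unfolding PvMD_def fg_ring_ideal_def by (metis finite.emptyI finite.insertI)
  then obtain T where T: "finite T" "T \<subseteq> frac_mult ?A (frac_inverse ?A)"
    "frac_inverse T \<subseteq> range to_fract"
    unfolding t_invertible_def by (rule finite_subset_if_t_closure_eq_D)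
  have "\<not> T \<subseteq> to_fract ` P"
  proof
    assume "T \<subseteq> to_fract ` P"
    then obtain S where S: "finite S" "S \<subseteq> P" "T = to_fract ` S"
      using finite_subset_image[OF T(1)] by metis
    have "x dvd u" if "\<forall>s\<in>S. x dvd u * s" for u
    proof -
      have "to_fract u / to_fract x \<in> frac_inverse T"
        using that quotient_mult_integral_iff[OF x] by (auto simp: frac_inverse_def S(3))
      then have "to_fract u / to_fract x * to_fract 1 \<in> range to_fract" using T(3) by auto
      then show ?thesis unfolding quotient_mult_integral_iff[OF x] by simp
    qed
    moreover have "\<forall>s\<in>S. \<exists>n. x dvd s ^ n" using S(2) unfolding P by (metis radical_principal_iff subsetD)
    then obtain n where "\<forall>s\<in>S. x dvd s ^ n s" by metis
    ultimately have "x dvd 1" using dvd_one_if_dvd_powers[OF S(1)] by blast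
    then have "y \<in> P" for y
      using dvd_trans[OF _ one_dvd[of "y ^ 1"]] unfolding P radical_principal_iff by blast
    then show False using prime by (auto simp: prime_ideal_def)
  qed
  then have "\<not> module.span frac_scale {i * y |i y. i \<in> ?A \<and> y \<in> frac_inverse ?A} \<subseteq> to_fract ` P"
    using T(2) unfolding frac_mult_def by (meson order_trans)
  then have "\<not> {i * y |i y. i \<in> ?A \<and> y \<in> frac_inverse ?A} \<subseteq> to_fract ` P"
    using module.span_minimal[OF module_frac_scale _ P_sub] by (rule contrapos_nn)
  then obtain i y where iy: "i \<in> ?A" "y \<in> frac_inverse ?A" "i * y \<notin> to_fract ` P"
    by blast
  have "\<not> ?G \<subseteq> {z. y * z \<in> to_fract ` P}"
    using module.span_minimal[OF module_frac_scale _ subspace_colon[OF P_sub], of ?G y] iy(1,3)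
    unfolding A by (auto simp: mult.commute)
  moreover have "y \<in> frac_inverse ?G" using iy(2) unfolding A frac_inverse_span .
  then obtain s t where st: "y * to_fract a = to_fract s" "y * to_fract b = to_fract t"
    unfolding frac_inverse_def by auto
  ultimately have "s \<notin> P \<or> t \<notin> P" by auto
  have "to_fract (a * t) = to_fract (b * s)"
    by (simp add: st[symmetric])
  then have "a * t = b * s" by (simp only: to_fract_eq_iff)
  from \<open>s \<notin> P \<or> t \<notin> P\<close> show ?thesis
  proof
    assume "s \<notin> P"
    then show ?thesis using \<open>a * t = b * s\<close> by (intro exI[of _ s] exI[of _ t]) simp
  next
    assume "t \<notin> P"
    then show ?thesis using \<open>a * t = b * s\<close> by (intro exI[of _ t] exI[of _ s]) simp
  qed
qed

lemma valuation_domain_localization: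
  assumes prime: "prime_ideal (P :: 'a::idom set)"
    and comp: "\<And>a b. a \<noteq> 0 \<or> b \<noteq> 0 \<Longrightarrow> \<exists>s t. s \<notin> P \<and> (a * s = b * t \<or> b * s = a * t)"
  shows "valuation_domain (localization P)"
proof -
  have ideal: "ring_ideal P" and "P \<noteq> UNIV" and mult: "\<And>s t. s \<notin> P \<Longrightarrow> t \<notin> P \<Longrightarrow> s * t \<notin> P"
    using prime unfolding prime_ideal_def by blast+
  have zero: "0 \<in> P" and smult: "\<And>c x. x \<in> P \<Longrightarrow> c * x \<in> P"
    using ideal unfolding ring_ideal_def module.subspace_def[OF module_ring] by blast+
  have one: "1 \<notin> P" using \<open>P \<noteq> UNIV\<close> smult by (metis UNIV_eq_I mult.right_neutral)
  have nz: "s \<noteq> 0" if "s \<notin> P" for s using that zero by blast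
  have intro: "x \<in> localization P" if "x * to_fract s = to_fract a" "s \<notin> P" for x a s
  proof -
    have "x = to_fract a / to_fract s" using that(1) nz[OF that(2)] by (simp add: eq_divide_eq)
    then show ?thesis using that(2) unfolding localization_def by blast
  qed
  have subring: "is_subring (localization P)"
    unfolding is_subring_def
  proof (intro conjI ballI)
    show "0 \<in> localization P" by (rule intro[of 0 1 0]) (simp_all add: one)
    show "1 \<in> localization P" by (rule intro[of 1 1 1]) (simp_all add: one)
    fix x y assume "x \<in> localization P" "y \<in> localization P"
    then obtain a s b t where x: "x = to_fract a / to_fract s" "s \<notin> P"
      and y: "y = to_fract b / to_fract t" "t \<notin> P"
      unfolding localization_def by blast
    note st = nz[OF x(2)] nz[OF y(2)] mult[OF x(2) y(2)]
    show "x - y \<in> localization P"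
      by (rule intro[of _ "s * t" "a * t - b * s"]) (use st in \<open>simp_all add: x(1) y(1) field_simps\<close>)
    show "x * y \<in> localization P"
      by (rule intro[of _ "s * t" "a * b"]) (use st in \<open>simp_all add: x(1) y(1) field_simps\<close>)
  qed
  have div: "\<exists>z\<in>localization P. y = x * z"
    if "x = to_fract a / to_fract s" "y = to_fract b / to_fract t" "s \<notin> P" "t \<notin> P"
      "r \<notin> P" "b * r = a * d" for x y a s b t r d
  proof
    have nz: "to_fract s \<noteq> 0" "to_fract t \<noteq> 0" "to_fract r \<noteq> 0"
      using that nz by simp_all
    let ?z = "to_fract (d * s) / to_fract (r * t)"
    show "?z \<in> localization P" using that mult unfolding localization_def by blast
    have "to_fract b * to_fract r = to_fract a * to_fract d"
      using that(6) by (simp add: to_fract_mult[symmetric] del: to_fract_mult)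
    then show "y = x * ?z" unfolding that(1,2) using nz by (simp add: field_simps)
  qed
  have "(\<exists>z\<in>localization P. y = x * z) \<or> (\<exists>z\<in>localization P. x = y * z)"
    if xy: "x \<in> localization P" "y \<in> localization P" for x y
  proof -
    obtain a s b t where x: "x = to_fract a / to_fract s" "s \<notin> P"
      and y: "y = to_fract b / to_fract t" "t \<notin> P"
      using xy unfolding localization_def by blast
    show ?thesis
    proof (cases "a = 0 \<and> b = 0")
      case True
      then have "y = x * 1" by (simp add: x y)
      then show ?thesis using subring unfolding is_subring_def by blast
    next
      case False
      then obtain r d where "r \<notin> P" "a * r = b * d \<or> b * r = a * d" using comp by blast
      then show ?thesis using div[OF x(1) y(1) x(2) y(2)] div[OF y(1) x(1) y(2) x(2)] by blast
    qed
  qed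
  then show ?thesis unfolding valuation_domain_def using subring by blast
qed

section \<open>Localizations at the primes of Omega\<close>

text \<open>
Take \<open>a\<close> in \<open>A\<close> but not \<open>B\<close> and \<open>b\<close> in \<open>B\<close> but not \<open>A\<close>. If \<open>a\<close> divides \<open>b\<close> in the localization, then
\<open>b * s\<close> is a multiple of \<open>a\<close> for some \<open>s\<close> outside \<open>C\<close>, against primality of \<open>A\<close>; the other case
is symmetric.
\<close>

lemma primes_below_comparable:
  assumes A: "prime_ideal (A :: 'a::idom set)" and B: "prime_ideal B" and C: "prime_ideal C"
    and val: "valuation_domain (localization C)" and sub: "A \<union> B \<subseteq> C"
  shows "A \<subseteq> B \<or> B \<subseteq> A"
proof (rule ccontr)
  assume "\<not> ?thesis"
  then obtain a b where ab: "a \<in> A" "a \<notin> B" "b \<in> B" "b \<notin> A" by blast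
  have zero: "0 \<in> C" and one: "1 \<notin> C"
  proof -
    have ideal: "0 \<in> C" "\<And>c x. x \<in> C \<Longrightarrow> c * x \<in> C"
      using C unfolding prime_ideal_def ring_ideal_def module.subspace_def[OF module_ring] by blast+
    then show "0 \<in> C" by blast
    show "1 \<notin> C" using C ideal(2) unfolding prime_ideal_def by (metis UNIV_eq_I mult.right_neutral)
  qed
  have "to_fract d \<in> localization C" for d
    using one unfolding localization_def by (metis (mono_tags, lifting) div_by_1 mem_Collect_eq to_fract_1)
  then have "(\<exists>z\<in>localization C. to_fract b = to_fract a * z) \<or>
      (\<exists>z\<in>localization C. to_fract a = to_fract b * z)"
    using val unfolding valuation_domain_def by blast
  moreover have False
    if A: "prime_ideal A" "A \<subseteq> C" "a \<in> A" "b \<notin> A"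
      and zz: "z \<in> localization C" "to_fract b = to_fract a * z"
    for A a b z
  proof -
    obtain d s where z: "z = to_fract d / to_fract s" "s \<notin> C"
      using zz(1) unfolding localization_def by blast
    have "s \<noteq> 0" using z(2) zero by blast
    then have "to_fract (b * s) = to_fract (a * d)" using zz(2) z(1) by (simp add: field_simps)
    then have "b * s = d * a" by (simp only: to_fract_eq_iff mult.commute)
    moreover have "d * a \<in> A"
      using A(1,3) unfolding prime_ideal_def ring_ideal_def module.subspace_def[OF module_ring] by blast
    ultimately have "b \<in> A \<or> s \<in> A" using A(1) unfolding prime_ideal_def by metis
    then show False using A(2,4) z(2) by blast
  qed
  ultimately show False using A B ab sub by (metis Un_subset_iff)
qed

text \<open>
A nonunit common divisor \<open>c\<close> is a valuation element, so its radical is a member of \<open>Omega\<close> above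
those of \<open>a\<close> and \<open>b\<close>. These are then comparable, so one of \<open>a\<close>, \<open>b\<close> divides a power of the other.
\<close>

lemma incomparable_coprime_if_Omega_tree:
  assumes tree: "\<forall>A \<in> (Omega :: 'a::idom set set). \<forall>B \<in> Omega. \<forall>C \<in> Omega.
            A \<union> B \<subseteq> C \<longrightarrow> A \<subseteq> B \<or> B \<subseteq> A"
    and a: "valuation_element (a::'a)" and b: "valuation_element b" and inc: "incomparable a b"
  shows "coprime_elts a b"
  unfolding coprime_elts_iff
proof (intro allI impI, rule ccontr)
  fix c assume c: "c dvd a" "c dvd b" "\<not> c dvd 1"
  have vu: "valuation_or_unit a" "valuation_or_unit b"
    using a b by (auto simp: valuation_element_iff)
  have vc: "valuation_element c"
    using valuation_or_unit_dvd[OF vu(1) c(1)] c(3) by (simp add: valuation_element_iff)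
  have Omega: "radical (principal v) \<in> Omega" if "valuation_element v" for v :: 'a
  proof -
    have "v \<noteq> 0" using that by (simp add: valuation_element_iff valuation_or_unit_def)
    then show ?thesis
      using prime_ideal_radical_valuation_element[OF that] unfolding Omega_def by blast
  qed
  have "radical (principal v) \<subseteq> radical (principal c)" if "c dvd v" for v
  proof
    fix y assume "y \<in> radical (principal v)"
    then obtain n where "n \<ge> 1" "v dvd y ^ n" by (auto simp: radical_principal_iff)
    then show "y \<in> radical (principal c)"
      using dvd_trans[OF \<open>c dvd v\<close>] unfolding radical_principal_iff by blast
  qed
  then have "radical (principal a) \<union> radical (principal b) \<subseteq> radical (principal c)"
    using c(1,2) by blast
  then have "radical (principal a) \<subseteq> radical (principal b) \<or>
      radical (principal b) \<subseteq> radical (principal a)"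
    using tree Omega a b vc by blast
  moreover have "v \<in> radical (principal v)" for v :: 'a
    unfolding radical_principal_iff by (rule exI[of _ 1]) simp
  ultimately have "a \<in> radical (principal b) \<or> b \<in> radical (principal a)" by blast
  then obtain n where "b dvd a ^ n \<or> a dvd b ^ n" by (auto simp: radical_principal_iff)
  then show False using comparable_if_dvd_power vu inc unfolding incomparable_iff by blast
qed

theorem theorem4p2:
  assumes "VFD TYPE('a::idom)"
  shows
    "(UVFD TYPE('a) \<longleftrightarrow>
        (\<forall>a b :: 'a. valuation_element a \<and> valuation_element b \<and> incomparable a b
            \<longrightarrow> coprime_elts a b)) \<and>
     (UVFD TYPE('a) \<longleftrightarrow> PvMD TYPE('a)) \<and>
     (UVFD TYPE('a) \<longleftrightarrow>
        (\<forall>P \<in> (Omega :: 'a set set). valuation_domain (localization P))) \<and>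
     (UVFD TYPE('a) \<longleftrightarrow>
        (\<forall>A \<in> (Omega :: 'a set set). \<forall>B \<in> Omega. \<forall>C \<in> Omega.
            A \<union> B \<subseteq> C \<longrightarrow> A \<subseteq> B \<or> B \<subseteq> A))"
    (is "(?U \<longleftrightarrow> ?C) \<and> (?U \<longleftrightarrow> ?P) \<and> (?U \<longleftrightarrow> ?L) \<and> (?U \<longleftrightarrow> ?T)")
proof -
  have "?U \<Longrightarrow> ?C" using incomparable_coprime_if_UVFD by blast
  moreover have "?C \<Longrightarrow> ?P"
    by (rule PvMD_if_v_gcd, rule v_gcd_exists[OF assms])
  moreover have "?P \<Longrightarrow> ?L"
  proof
    fix P :: "'a set" assume PvMD: ?P and "P \<in> Omega"
    then obtain x where x: "x \<noteq> 0" "P = radical (principal x)" "prime_ideal P"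
      unfolding Omega_def by blast
    show "valuation_domain (localization P)"
      by (rule valuation_domain_localization[OF x(3) PvMD_imp_comparable_outside[OF PvMD x]])
  qed
  moreover have "?L \<Longrightarrow> ?T"
  proof (intro ballI impI)
    fix A B C :: "'a set"
    assume L: ?L and ABC: "A \<in> Omega" "B \<in> Omega" "C \<in> Omega" "A \<union> B \<subseteq> C"
    have "prime_ideal P" if "P \<in> Omega" for P :: "'a set" using that unfolding Omega_def by blast
    then show "A \<subseteq> B \<or> B \<subseteq> A" using primes_below_comparable[of A B C] L ABC by blast
  qed
  moreover have "?T \<Longrightarrow> ?C" using incomparable_coprime_if_Omega_tree by blast
  moreover have "?C \<Longrightarrow> ?U" by (rule UVFD_if_incomparable_coprime[OF assms])
  ultimately show ?thesis by blast
qed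

end
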